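(* Let $n\ge1$ be a positive integer and let $w\in\mathcal{F}_n$. Over the unit ball of $\mathfrak{L}_n$, the isometry $L_w$ factors only in the same way as the word $w$, modulo scalars in $\mathbb{T}$. That is, if $L_w=BC$ with $B,C\in\mathfrak{L}_n$, $\|B\|\le1$ and $\|C\|\le 1$, then there are words $u,v\in\mathcal{F}_n$ with $w=uv$ and a scalar $\lambda\in\mathbb{T}$ such that $B=\lambda L_u$ and $C=\bar\lambda L_v$.
   Context: Let $\mathcal{F}_n$ be the unital free semigroup on $n$ generators $z_1,\dots,z_n$ (its unit is the empty word $1$), and let $\mathcal{H}_n=\ell_2(\mathcal{F}_n)$, with orthonormal basis $\{\xi_w: w\in\mathcal{F}_n\}$. For $w\in\mathcal{F}_n$ let $L_w$ be the isometry on $\mathcal{H}_n$ with $L_w\xi_v=\xi_{wv}$, and put $L_i=L_{z_i}$. The non-commutative analytic Toeplitz algebra $\mathfrak{L}_n$ is the unital algebra, closed in the weak operator topology, generated by $L_1,\dots,L_n$ in $\mathcal{B}(\mathcal{H}_n)$. $\mathbb{T}$ is the unit circle. *)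

theory Defs
  imports "HOL-Analysis.Analysis"
begin

section \<open>The complex Hilbert space of square-summable families\<close>

lemma square_summable_mult:
  fixes f g :: "'a \<Rightarrow> complex"
  assumes "(\<lambda>x. (cmod (f x))\<^sup>2) summable_on UNIV" "(\<lambda>x. (cmod (g x))\<^sup>2) summable_on UNIV"
  shows "(\<lambda>x. f x * cnj (g x)) summable_on UNIV"
proof -
  have "(\<lambda>x. (cmod (f x))\<^sup>2 + (cmod (g x))\<^sup>2) summable_on UNIV"
    using assms by (rule summable_on_add)
  moreover have "norm (f x * cnj (g x)) \<le> (cmod (f x))\<^sup>2 + (cmod (g x))\<^sup>2" for x
  proof -
    have "2 * (cmod (f x) * cmod (g x)) \<le> (cmod (f x))\<^sup>2 + (cmod (g x))\<^sup>2"
      using sum_squares_bound[of "cmod (f x)" "cmod (g x)"] by (simp add: mult.assoc)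
    moreover have "0 \<le> cmod (f x) * cmod (g x)" by simp
    ultimately show ?thesis unfolding norm_mult complex_mod_cnj by linarith
  qed
  ultimately have "(\<lambda>x. norm (f x * cnj (g x))) summable_on UNIV"
    by (rule Infinite_Sum.abs_summable_on_comparison_test')
  then show ?thesis by (rule Infinite_Sum.abs_summable_summable)
qed

lemma square_summable_scale:
  fixes f :: "'a \<Rightarrow> complex"
  assumes "(\<lambda>x. (cmod (f x))\<^sup>2) summable_on UNIV"
  shows "(\<lambda>x. (cmod (c * f x))\<^sup>2) summable_on UNIV"
  using summable_on_cmult_right[OF assms, of "(cmod c)\<^sup>2"]
  by (simp add: norm_mult power_mult_distrib)

lemma square_summable_add:
  fixes f g :: "'a \<Rightarrow> complex"
  assumes "(\<lambda>x. (cmod (f x))\<^sup>2) summable_on UNIV" "(\<lambda>x. (cmod (g x))\<^sup>2) summable_on UNIV"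
  shows "(\<lambda>x. (cmod (f x + g x))\<^sup>2) summable_on UNIV"
proof -
  have "(\<lambda>x. 2 * ((cmod (f x))\<^sup>2 + (cmod (g x))\<^sup>2)) summable_on UNIV"
    using assms by (intro summable_on_cmult_right summable_on_add)
  moreover have "(cmod (f x + g x))\<^sup>2 \<le> 2 * ((cmod (f x))\<^sup>2 + (cmod (g x))\<^sup>2)" for x
  proof -
    have "(cmod (f x + g x))\<^sup>2 \<le> (cmod (f x) + cmod (g x))\<^sup>2"
      by (intro power_mono norm_triangle_ineq norm_ge_zero)
    also have "\<dots> \<le> 2 * ((cmod (f x))\<^sup>2 + (cmod (g x))\<^sup>2)"
      using sum_squares_bound[of "cmod (f x)" "cmod (g x)"] by (simp add: power2_sum)
    finally show ?thesis .
  qed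
  ultimately show ?thesis by (rule summable_on_comparison_test) simp
qed

typedef 'a ell2 = "{f :: 'a \<Rightarrow> complex. (\<lambda>x. (cmod (f x))\<^sup>2) summable_on UNIV}"
  morphisms ell2_coeff Abs_ell2
  by (rule exI[of _ "\<lambda>_. 0"]) simp

setup_lifting type_definition_ell2

lemma ell2_coeff_square_summable: "(\<lambda>x. (cmod (ell2_coeff f x))\<^sup>2) summable_on UNIV"
  using ell2_coeff[of f] by simp

lift_definition ell2_scale :: "complex \<Rightarrow> 'a ell2 \<Rightarrow> 'a ell2" (infixr "*\<^sub>\<complex>" 75)
  is "\<lambda>c f x. c * f x"
  by (rule square_summable_scale)

lift_definition ket :: "'a \<Rightarrow> 'a ell2" ("\<xi>")
  is "\<lambda>a x. if x = a then 1 else 0"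
proof -
  fix a :: 'a
  show "(\<lambda>x. (cmod (if x = a then 1 else 0))\<^sup>2) summable_on UNIV"
    by (rule finite_nonzero_values_imp_summable_on) (auto intro: finite_subset[of _ "{a}"])
qed

lift_definition cinner :: "'a ell2 \<Rightarrow> 'a ell2 \<Rightarrow> complex"
  is "\<lambda>f g. (\<Sum>\<^sub>\<infinity>x. f x * cnj (g x))" .

instantiation ell2 :: (type) real_vector
begin

lift_definition zero_ell2 :: "'a ell2" is "\<lambda>_. 0" by simp
lift_definition plus_ell2 :: "'a ell2 \<Rightarrow> 'a ell2 \<Rightarrow> 'a ell2" is "\<lambda>f g x. f x + g x"
  by (rule square_summable_add)
lift_definition uminus_ell2 :: "'a ell2 \<Rightarrow> 'a ell2" is "\<lambda>f x. - f x" by simp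
lift_definition minus_ell2 :: "'a ell2 \<Rightarrow> 'a ell2 \<Rightarrow> 'a ell2" is "\<lambda>f g x. f x - g x"
  using square_summable_add[of _ "\<lambda>x. - _ x"] by simp
lift_definition scaleR_ell2 :: "real \<Rightarrow> 'a ell2 \<Rightarrow> 'a ell2" is "\<lambda>r f x. complex_of_real r * f x"
  by (rule square_summable_scale)

instance
  by standard (transfer; simp add: fun_eq_iff algebra_simps)+

end

text \<open>The norm is the usual one, $\|f\|^2 = \sum_x |f(x)|^2$. The real inner product required by
  the class is the real part of \<^const>\<open>cinner\<close>; it induces the same norm.\<close>

instantiation ell2 :: (type) real_inner
begin

lift_definition norm_ell2 :: "'a ell2 \<Rightarrow> real" is "\<lambda>f. sqrt (\<Sum>\<^sub>\<infinity>x. (cmod (f x))\<^sup>2)" .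
definition inner_ell2 :: "'a ell2 \<Rightarrow> 'a ell2 \<Rightarrow> real" where "inner_ell2 f g = Re (cinner f g)"
definition dist_ell2 :: "'a ell2 \<Rightarrow> 'a ell2 \<Rightarrow> real" where "dist_ell2 f g = norm (f - g)"
definition sgn_ell2 :: "'a ell2 \<Rightarrow> 'a ell2" where "sgn_ell2 f = f /\<^sub>R norm f"
definition uniformity_ell2 :: "('a ell2 \<times> 'a ell2) filter"
  where "uniformity_ell2 = (INF e\<in>{0 <..}. principal {(f, g). dist f g < e})"
definition open_ell2 :: "'a ell2 set \<Rightarrow> bool"
  where "open_ell2 U \<longleftrightarrow> (\<forall>f\<in>U. eventually (\<lambda>(f', g). f' = f \<longrightarrow> g \<in> U) uniformity)"

instance
proof
  fix f g h :: "'a ell2" and r :: real and U :: "'a ell2 set"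
  have cinner_self: "cinner f f = complex_of_real (\<Sum>\<^sub>\<infinity>x. (cmod (ell2_coeff f x))\<^sup>2)"
  proof -
    have "cinner f f = (\<Sum>\<^sub>\<infinity>x. complex_of_real ((cmod (ell2_coeff f x))\<^sup>2))"
      unfolding cinner.rep_eq by (simp add: complex_norm_square del: of_real_power)
    also have "\<dots> = complex_of_real (\<Sum>\<^sub>\<infinity>x. (cmod (ell2_coeff f x))\<^sup>2)"
      by (intro infsumI has_sum_of_real has_sum_infsum ell2_coeff_square_summable)
    finally show ?thesis .
  qed
  show "inner f g = inner g f"
  proof -
    have "cinner g f = cnj (cinner f g)"
      unfolding cinner.rep_eq by (simp flip: infsum_cnj add: mult.commute)
    then show ?thesis unfolding inner_ell2_def by simp
  qed
  show "inner (f + g) h = inner f h + inner g h"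
    unfolding inner_ell2_def cinner.rep_eq plus_ell2.rep_eq
    by (simp add: distrib_right infsum_add square_summable_mult ell2_coeff_square_summable)
  show "inner (r *\<^sub>R f) g = r * inner f g"
    unfolding inner_ell2_def cinner.rep_eq scaleR_ell2.rep_eq
    by (simp add: mult.assoc infsum_cmult_right')
  show "0 \<le> inner f f"
    unfolding inner_ell2_def cinner_self by (simp add: infsum_nonneg)
  show "inner f f = 0 \<longleftrightarrow> f = 0"
  proof
    assume "inner f f = 0"
    then have "(\<Sum>\<^sub>\<infinity>x. (cmod (ell2_coeff f x))\<^sup>2) \<le> 0"
      unfolding inner_ell2_def cinner_self by simp
    then have "(cmod (ell2_coeff f x))\<^sup>2 = 0" for x
      by (rule nonneg_infsum_le_0D[OF _ ell2_coeff_square_summable]) auto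
    then show "f = 0" by (transfer) (simp add: fun_eq_iff)
  next
    assume "f = 0"
    then show "inner f f = 0" unfolding inner_ell2_def by (simp add: cinner.rep_eq zero_ell2.rep_eq)
  qed
  show "norm f = sqrt (inner f f)"
    unfolding inner_ell2_def cinner_self by (simp add: norm_ell2.rep_eq)
qed (simp_all add: dist_ell2_def sgn_ell2_def uniformity_ell2_def open_ell2_def)

end

lemma ell2_scale_of_real: "complex_of_real r *\<^sub>\<complex> f = r *\<^sub>R f"
  by transfer simp

lemma ell2_scale_add: "c *\<^sub>\<complex> (f + g) = c *\<^sub>\<complex> f + c *\<^sub>\<complex> g"
  by transfer (simp add: distrib_left)

lemma ell2_scale_scaleR: "c *\<^sub>\<complex> (r *\<^sub>R f) = r *\<^sub>R (c *\<^sub>\<complex> f)"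
  by transfer (simp add: mult_ac)

lemma norm_ell2_scale: "norm (c *\<^sub>\<complex> f) = cmod c * norm f"
  by transfer (simp add: norm_mult power_mult_distrib infsum_cmult_right' real_sqrt_mult)

lemma bounded_linear_ell2_scale: "bounded_linear (\<lambda>f. c *\<^sub>\<complex> f)"
  by (rule bounded_linear_intro[of _ "cmod c"])
    (simp_all add: ell2_scale_add ell2_scale_scaleR norm_ell2_scale mult.commute)


section \<open>Bounded operators and the weak operator topology\<close>

text \<open>The library only provides real-linear bounded operators; the complex-linear ones are the
  elements of \<open>bounded_ops\<close>. The norm of a complex-linear operator does not depend on which
  scalar field is used, so \<^const>\<open>norm\<close> on \<open>\<Rightarrow>\<^sub>L\<close> is its operator norm.\<close>

definition bounded_ops :: "('a ell2 \<Rightarrow>\<^sub>L 'a ell2) set"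
  where "bounded_ops = {A. \<forall>c f. blinfun_apply A (c *\<^sub>\<complex> f) = c *\<^sub>\<complex> blinfun_apply A f}"

definition op_scale :: "complex \<Rightarrow> ('a ell2 \<Rightarrow>\<^sub>L 'a ell2) \<Rightarrow> ('a ell2 \<Rightarrow>\<^sub>L 'a ell2)"
    (infixr "*\<^sub>o" 75)
  where "c *\<^sub>o A = Blinfun (\<lambda>f. c *\<^sub>\<complex> blinfun_apply A f)"

lemma op_scale_apply [simp]: "blinfun_apply (c *\<^sub>o A) f = c *\<^sub>\<complex> blinfun_apply A f"
  unfolding op_scale_def
  by (subst bounded_linear_Blinfun_apply)
    (auto intro: bounded_linear_compose[OF bounded_linear_ell2_scale] blinfun.bounded_linear_right)

text \<open>The coarsest topology on \<^const>\<open>bounded_ops\<close> for which all the maps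
  $A \mapsto \langle A f, g\rangle$ are continuous: it is pulled back from the product topology
  on the functions of the pair $(f, g)$.\<close>

definition weak_operator_topology :: "('a ell2 \<Rightarrow>\<^sub>L 'a ell2) topology"
  where "weak_operator_topology =
    pullback_topology bounded_ops (\<lambda>A (f, g). cinner (blinfun_apply A f) g) euclidean"

definition unital_subalgebra :: "('a ell2 \<Rightarrow>\<^sub>L 'a ell2) set \<Rightarrow> bool"
  where "unital_subalgebra S \<longleftrightarrow>
    S \<subseteq> bounded_ops \<and> id_blinfun \<in> S \<and>
    (\<forall>A\<in>S. \<forall>B\<in>S. A + B \<in> S) \<and>
    (\<forall>c. \<forall>A\<in>S. c *\<^sub>o A \<in> S) \<and>
    (\<forall>A\<in>S. \<forall>B\<in>S. A o\<^sub>L B \<in> S)"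

definition wot_algebra_generated :: "('a ell2 \<Rightarrow>\<^sub>L 'a ell2) set \<Rightarrow> ('a ell2 \<Rightarrow>\<^sub>L 'a ell2) set"
  where "wot_algebra_generated G =
    \<Inter>{S. unital_subalgebra S \<and> closedin weak_operator_topology S \<and> G \<subseteq> S}"


section \<open>The non-commutative analytic Toeplitz algebra\<close>

text \<open>The unital free semigroup on generators indexed by \<open>'n\<close> (so $n$ is \<open>CARD('n)\<close>) is \<open>'n list\<close>, with concatenation
  as multiplication, the empty list as unit, and \<open>[i]\<close> as the generator $z_i$.\<close>

lemma left_mult_has_sum:
  fixes f :: "'n list \<Rightarrow> complex"
  assumes "(\<lambda>x. (cmod (f x))\<^sup>2) summable_on UNIV"
  shows "((\<lambda>x. (cmod (if take (length w) x = w then f (drop (length w) x) else 0))\<^sup>2)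
    has_sum (\<Sum>\<^sub>\<infinity>x. (cmod (f x))\<^sup>2)) UNIV" (is "(?h has_sum ?s) UNIV")
proof -
  have "((?h \<circ> (@) w) has_sum ?s) UNIV"
    using has_sum_infsum[OF assms] by (simp add: o_def)
  then have "(?h has_sum ?s) (range ((@) w))"
    by (subst has_sum_reindex) (auto simp: inj_on_def)
  moreover have "?h x = 0" if "x \<notin> range ((@) w)" for x
  proof -
    have "take (length w) x \<noteq> w"
    proof
      assume "take (length w) x = w"
      then have "x = w @ drop (length w) x"
        using append_take_drop_id[of "length w" x] by simp
      with that show False by blast
    qed
    then show ?thesis by simp
  qed
  ultimately show ?thesis
    by (subst has_sum_cong_neutral[where S = UNIV and T = "range ((@) w)" and g = ?h]) auto
qed

text \<open>$L_w$ maps $f = \sum_v f(v)\,\xi_v$ to $\sum_v f(v)\,\xi_{wv}$, whose coefficient at $x$ is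
  $f(v)$ if $x = wv$, and $0$ if $x$ does not begin with $w$.\<close>

lift_definition left_mult_fun :: "'n list \<Rightarrow> 'n list ell2 \<Rightarrow> 'n list ell2"
  is "\<lambda>w f x. if take (length w) x = w then f (drop (length w) x) else 0"
  by (rule has_sum_imp_summable[OF left_mult_has_sum])

lemma norm_left_mult_fun: "norm (left_mult_fun w f) = norm f"
  by transfer (simp add: infsumI[OF left_mult_has_sum])

lift_definition left_mult :: "'n list \<Rightarrow> ('n list ell2 \<Rightarrow>\<^sub>L 'n list ell2)" ("\<L>")
  is left_mult_fun
proof (rule bounded_linear_intro[of _ 1])
  fix w :: "'n list" and f g :: "'n list ell2" and r :: real
  show "left_mult_fun w (f + g) = left_mult_fun w f + left_mult_fun w g"
    by transfer (simp add: fun_eq_iff)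
  show "left_mult_fun w (r *\<^sub>R f) = r *\<^sub>R left_mult_fun w f"
    by transfer (simp add: fun_eq_iff)
  show "norm (left_mult_fun w f) \<le> norm f * 1"
    by (simp add: norm_left_mult_fun)
qed

lemma norm_left_mult: "norm (blinfun_apply (\<L> w) f) = norm f"
  by (simp add: left_mult.rep_eq norm_left_mult_fun)

lemma left_mult_in_bounded_ops: "\<L> w \<in> bounded_ops"
proof -
  have "left_mult_fun w (c *\<^sub>\<complex> f) = c *\<^sub>\<complex> left_mult_fun w f" for c and f :: "'a list ell2"
    by transfer (simp add: fun_eq_iff)
  then show ?thesis by (simp add: bounded_ops_def left_mult.rep_eq)
qed

lemma left_mult_ket: "blinfun_apply (\<L> w) (\<xi> v) = \<xi> (w @ v)"
proof -
  have "left_mult_fun w (\<xi> v) = \<xi> (w @ v)"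
  proof transfer
    fix w v :: "'a list"
    have "take (length w) x = w \<and> drop (length w) x = v \<longleftrightarrow> x = w @ v" for x
      using append_eq_conv_conj[of w v x] by auto
    then show "(\<lambda>x. if take (length w) x = w then if drop (length w) x = v then 1 else 0 else 0) =
        (\<lambda>x. if x = w @ v then 1 else 0 :: complex)"
      by (auto simp: fun_eq_iff)
  qed
  then show ?thesis by (simp add: left_mult.rep_eq)
qed

definition nc_toeplitz_algebra :: "('n list ell2 \<Rightarrow>\<^sub>L 'n list ell2) set" ("\<LL>")
  where "\<LL> = wot_algebra_generated (range (\<lambda>i. \<L> [i]))"

end

theory Submission
  imports Defs
begin

text \<open>Every operator \<open>A\<close> in \<open>\<LL>\<close> is a left convolution by its symbol, the vector
  \<open>A \<xi>\<^sub>1\<close>, where \<open>1\<close> is the empty word: the value of \<open>A f\<close> at a word \<open>x\<close> is the finite sum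
  of \<open>(A \<xi>\<^sub>1)(u) f(v)\<close> over the factorizations \<open>x = u v\<close>. The reason is that the operators of this kind form a unital algebra,
  because convolution is associative; they contain the generators; and the condition relates
  finitely many matrix coefficients at a time, so that it survives weak operator limits.

  Let now \<open>b\<close> and \<open>c\<close> be the symbols of \<open>B\<close> and \<open>C\<close>. The equation for \<open>L\<^sub>w\<close> says that the
  convolution of \<open>b\<close> and \<open>c\<close> is the indicator of \<open>w\<close>. Choose words \<open>u\<close> and \<open>v\<close> of least length
  with \<open>b(u)\<close> and \<open>c(v)\<close> nonzero. No other factorization of \<open>u v\<close> contributes to the
  convolution, which therefore takes there the nonzero value \<open>b(u) c(v)\<close>. Hence \<open>u v = w\<close> and
  \<open>b(u) c(v) = 1\<close>. The symbols are vectors in the unit ball, so both factors are unimodular, and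
  then \<open>b\<close> and \<open>c\<close> have no room for a second nonzero coefficient. Finally, an operator in the
  algebra is determined by its symbol.\<close>

section \<open>Convolution of functions on words\<close>

definition word_conv :: "('a list \<Rightarrow> 'b::comm_semiring_1) \<Rightarrow> ('a list \<Rightarrow> 'b) \<Rightarrow> 'a list \<Rightarrow> 'b"
  where "word_conv a b x = (\<Sum>k\<le>length x. a (take k x) * b (drop k x))"

lemma word_conv_Nil: "word_conv a b [] = a [] * b []"
  by (simp add: word_conv_def)

text \<open>Splitting off the factorization with empty left factor turns convolution into a structural
  recursion on the word, so that associativity needs no rearrangement of double sums.\<close>

lemma word_conv_Cons:
  "word_conv a b (x # xs) = a [] * b (x # xs) + word_conv (\<lambda>y. a (x # y)) b xs"
  by (simp add: word_conv_def sum.atMost_Suc_shift del: sum.atMost_Suc)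

lemma word_conv_add_left:
  "word_conv (\<lambda>x. a x + a' x) b x = word_conv a b x + word_conv a' b x"
  by (simp add: word_conv_def distrib_right sum.distrib)

lemma word_conv_scale_left: "word_conv (\<lambda>x. c * a x) b x = c * word_conv a b x"
  by (simp add: word_conv_def sum_distrib_left mult.assoc)

lemma word_conv_assoc: "word_conv (word_conv a b) c x = word_conv a (word_conv b c) x"
proof (induction x arbitrary: a)
  case Nil
  show ?case by (simp add: word_conv_Nil mult.assoc)
next
  case (Cons x xs)
  then show ?case
    by (simp add: word_conv_Cons word_conv_Nil word_conv_add_left word_conv_scale_left
        distrib_left mult.assoc add.assoc)
qed

lemma word_conv_indicator:
  "word_conv (\<lambda>y. if y = u then 1 else 0) b x =
    (if take (length u) x = u then b (drop (length u) x) else 0)"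
proof -
  have "(if take k x = u then 1 else 0) * b (drop k x) =
      (if k = length u then if take (length u) x = u then b (drop (length u) x) else 0 else 0)"
    if "k \<le> length x" for k
    using that by auto
  then have "word_conv (\<lambda>y. if y = u then 1 else 0) b x = (\<Sum>k\<le>length x.
      if k = length u then if take (length u) x = u then b (drop (length u) x) else 0 else 0)"
    unfolding word_conv_def by (intro sum.cong) auto
  also have "\<dots> = (if length u \<le> length x \<and> take (length u) x = u
      then b (drop (length u) x) else 0)"
    by simp
  also have "\<dots> = (if take (length u) x = u then b (drop (length u) x) else 0)"
    by (metis length_take min.cobounded1)
  finally show ?thesis .
qed

text \<open>Cutting \<open>u @ v\<close> elsewhere than after \<open>u\<close> makes one of the two pieces shorter than the
  shortest word in the support of its factor.\<close>

lemma word_conv_lowest_terms: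
  assumes "\<And>y. length y < length u \<Longrightarrow> a y = 0" and "\<And>y. length y < length v \<Longrightarrow> b y = 0"
  shows "word_conv a b (u @ v) = a u * b v"
proof -
  have "word_conv a b (u @ v) = (\<Sum>k\<le>length (u @ v). if k = length u then a u * b v else 0)"
    unfolding word_conv_def
  proof (rule sum.cong[OF refl])
    fix k assume "k \<in> {..length (u @ v)}"
    then show "a (take k (u @ v)) * b (drop k (u @ v)) = (if k = length u then a u * b v else 0)"
      using assms(1)[of "take k (u @ v)"] assms(2)[of "drop k (u @ v)"]
      by (cases k "length u" rule: linorder_cases) auto
  qed
  then show ?thesis by simp
qed

lemma obtain_shortest_in_support:
  assumes "a \<noteq> (\<lambda>_. 0)"
  obtains u where "a u \<noteq> 0" "\<And>y. length y < length u \<Longrightarrow> a y = 0"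
proof -
  obtain y where "a y \<noteq> 0" using assms by auto
  then obtain u where u: "a u \<noteq> 0" "\<forall>y. a y \<noteq> 0 \<longrightarrow> length u \<le> length y"
    using ex_has_least_nat[of "\<lambda>u. a u \<noteq> 0" y length] by auto
  then have "a y = 0" if "length y < length u" for y
    using that by (meson not_less)
  with u(1) show thesis by (rule that)
qed

lemma word_conv_eq_indicatorD:
  fixes a b :: "'a list \<Rightarrow> 'b::idom"
  assumes "word_conv a b = (\<lambda>x. if x = w then 1 else 0)"
  obtains u v where "w = u @ v" "a u * b v = 1"
proof -
  have "word_conv a b w \<noteq> 0" by (simp add: assms)
  then have "a \<noteq> (\<lambda>_. 0)" and "b \<noteq> (\<lambda>_. 0)" by (auto simp: word_conv_def)
  obtain u where u: "a u \<noteq> 0" "\<And>y. length y < length u \<Longrightarrow> a y = 0"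
    using obtain_shortest_in_support[OF \<open>a \<noteq> (\<lambda>_. 0)\<close>] by blast
  obtain v where v: "b v \<noteq> 0" "\<And>y. length y < length v \<Longrightarrow> b y = 0"
    using obtain_shortest_in_support[OF \<open>b \<noteq> (\<lambda>_. 0)\<close>] by blast
  have "a u * b v = (if u @ v = w then 1 else 0)"
    using word_conv_lowest_terms[of u a v b, OF u(2) v(2)] by (simp add: assms)
  moreover have "a u * b v \<noteq> 0" using u(1) v(1) by simp
  ultimately show thesis using that[of u v] by (auto split: if_splits)
qed


section \<open>Coefficients of square-summable families\<close>

lemma ell2_eqI: "ell2_coeff f = ell2_coeff g \<Longrightarrow> f = g"
  by (simp add: ell2_coeff_inject)

lemma cinner_ket: "cinner f (\<xi> x) = ell2_coeff f x"
proof -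
  have "cinner f (\<xi> x) = (\<Sum>\<^sub>\<infinity>y\<in>{x}. ell2_coeff f y)"
    unfolding cinner.rep_eq ket.rep_eq by (intro infsum_cong_neutral) auto
  then show ?thesis by simp
qed

lemma norm_ket: "norm (\<xi> x) = 1"
proof -
  have "(\<Sum>\<^sub>\<infinity>y. (cmod (ell2_coeff (\<xi> x) y))\<^sup>2) = (\<Sum>\<^sub>\<infinity>y\<in>{x}. 1)"
    unfolding ket.rep_eq by (intro infsum_cong_neutral) auto
  then show ?thesis by (simp add: norm_ell2.rep_eq)
qed

lemma sum_coeff_le_norm:
  assumes "finite F"
  shows "(\<Sum>x\<in>F. (cmod (ell2_coeff f x))\<^sup>2) \<le> (norm f)\<^sup>2"
proof -
  have "(\<Sum>x\<in>F. (cmod (ell2_coeff f x))\<^sup>2) \<le> (\<Sum>\<^sub>\<infinity>x. (cmod (ell2_coeff f x))\<^sup>2)"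
    by (rule finite_sum_le_infsum[OF ell2_coeff_square_summable assms]) auto
  also have "\<dots> = (norm f)\<^sup>2"
    by (simp add: norm_ell2.rep_eq infsum_nonneg)
  finally show ?thesis .
qed

lemma cmod_coeff_le_norm: "cmod (ell2_coeff f x) \<le> norm f"
  using sum_coeff_le_norm[of "{x}" f] by (simp add: power2_le_iff_abs_le)

text \<open>The squared moduli of the coefficients of a vector in the unit ball add up to at most one.\<close>

lemma unimodular_coeff_imp_scaled_ket:
  assumes "norm f \<le> 1" and "cmod (ell2_coeff f x) = 1"
  shows "f = ell2_coeff f x *\<^sub>\<complex> \<xi> x"
proof (rule ell2_eqI, rule ext)
  fix y
  have "ell2_coeff f y = 0" if "y \<noteq> x"
  proof -
    have "(cmod (ell2_coeff f x))\<^sup>2 + (cmod (ell2_coeff f y))\<^sup>2 \<le> (norm f)\<^sup>2"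
      using sum_coeff_le_norm[of "{x, y}" f] that by simp
    also have "\<dots> \<le> 1" using assms(1) by (simp add: power_le_one)
    finally show ?thesis using assms(2) by simp
  qed
  then show "ell2_coeff f y = ell2_coeff (ell2_coeff f x *\<^sub>\<complex> \<xi> x) y"
    by (simp add: ell2_scale.rep_eq ket.rep_eq)
qed


section \<open>Operators in the algebra are convolution operators\<close>

definition symbol :: "('n list ell2 \<Rightarrow>\<^sub>L 'n list ell2) \<Rightarrow> 'n list \<Rightarrow> complex"
  where "symbol A = ell2_coeff (blinfun_apply A (\<xi> []))"

definition convolution_ops :: "('n list ell2 \<Rightarrow>\<^sub>L 'n list ell2) set"
  where "convolution_ops = {A \<in> bounded_ops.
    \<forall>f. ell2_coeff (blinfun_apply A f) = word_conv (symbol A) (ell2_coeff f)}"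

lemma convolution_ops_coeff:
  "A \<in> convolution_ops \<Longrightarrow> ell2_coeff (blinfun_apply A f) = word_conv (symbol A) (ell2_coeff f)"
  by (simp add: convolution_ops_def)

lemma convolution_ops_eqI:
  assumes "A \<in> convolution_ops" "B \<in> convolution_ops" "symbol A = symbol B"
  shows "A = B"
  using assms by (intro blinfun_eqI ell2_eqI) (simp add: convolution_ops_coeff)

lemma symbol_scale: "symbol (c *\<^sub>o A) = (\<lambda>x. c * symbol A x)"
  by (simp add: symbol_def ell2_scale.rep_eq)

lemma symbol_add: "symbol (A + B) = (\<lambda>x. symbol A x + symbol B x)"
  by (simp add: symbol_def blinfun.add_left plus_ell2.rep_eq)

lemma symbol_compose:
  "A \<in> convolution_ops \<Longrightarrow> symbol (A o\<^sub>L B) = word_conv (symbol A) (symbol B)"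
  by (simp add: symbol_def[of "A o\<^sub>L B"] symbol_def[of B] convolution_ops_coeff)

lemma symbol_left_mult: "symbol (\<L> w) = (\<lambda>x. if x = w then 1 else 0)"
  by (simp add: symbol_def left_mult_ket ket.rep_eq)

lemma left_mult_in_convolution_ops: "\<L> w \<in> convolution_ops"
  by (simp add: convolution_ops_def left_mult_in_bounded_ops symbol_left_mult left_mult.rep_eq
      left_mult_fun.rep_eq word_conv_indicator fun_eq_iff)

lemma left_mult_Nil: "\<L> [] = id_blinfun"
  by (intro blinfun_eqI ell2_eqI) (simp add: left_mult.rep_eq left_mult_fun.rep_eq)

lemma scale_in_convolution_ops:
  assumes "A \<in> convolution_ops"
  shows "c *\<^sub>o A \<in> convolution_ops"
proof -
  have "c *\<^sub>\<complex> d *\<^sub>\<complex> f = d *\<^sub>\<complex> c *\<^sub>\<complex> f" for d and f :: "'a list ell2"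
    by transfer (simp add: mult.left_commute)
  then show ?thesis
    using assms by (auto simp: convolution_ops_def bounded_ops_def ell2_scale.rep_eq symbol_scale
        word_conv_scale_left fun_eq_iff)
qed

lemma unital_subalgebra_convolution_ops: "unital_subalgebra convolution_ops"
  unfolding unital_subalgebra_def
proof (intro conjI ballI allI)
  show "convolution_ops \<subseteq> bounded_ops" by (auto simp: convolution_ops_def)
  show "id_blinfun \<in> convolution_ops"
    using left_mult_in_convolution_ops[of "[]"] by (simp add: left_mult_Nil)
  fix A B :: "'a list ell2 \<Rightarrow>\<^sub>L 'a list ell2"
  assume A: "A \<in> convolution_ops" and B: "B \<in> convolution_ops"
  then have "A \<in> bounded_ops" "B \<in> bounded_ops" by (auto simp: convolution_ops_def)
  then have bounded: "A + B \<in> bounded_ops" "A o\<^sub>L B \<in> bounded_ops"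
    by (auto simp: bounded_ops_def blinfun.add_left ell2_scale_add)
  show "A + B \<in> convolution_ops"
    using A B bounded by (auto simp: convolution_ops_def blinfun.add_left plus_ell2.rep_eq
        symbol_add word_conv_add_left fun_eq_iff)
  have "ell2_coeff (blinfun_apply (A o\<^sub>L B) f) = word_conv (symbol (A o\<^sub>L B)) (ell2_coeff f)" for f
    using A B by (simp add: symbol_compose convolution_ops_coeff word_conv_assoc fun_eq_iff)
  with bounded show "A o\<^sub>L B \<in> convolution_ops" by (simp add: convolution_ops_def)
qed (rule scale_in_convolution_ops)

lemma topspace_weak_operator_topology: "topspace weak_operator_topology = bounded_ops"
  by (simp add: weak_operator_topology_def topspace_pullback_topology)

lemma continuous_map_coeff:
  "continuous_map weak_operator_topology euclidean (\<lambda>A. ell2_coeff (blinfun_apply A f) x)"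
proof -
  have "continuous_map euclidean euclidean (\<lambda>F :: _ \<Rightarrow> complex. F (f, \<xi> x))"
    by simp
  from continuous_map_pullback[OF this, of bounded_ops "\<lambda>A (f, g). cinner (blinfun_apply A f) g"]
  show ?thesis
    by (simp add: weak_operator_topology_def o_def cinner_ket)
qed

lemma continuous_map_coeff_mult:
  "continuous_map weak_operator_topology euclidean (\<lambda>A. ell2_coeff (blinfun_apply A f) x * c)"
proof -
  have "continuous_map euclidean euclidean (\<lambda>z::complex. z * c)"
    by (simp add: continuous_on_mult_right)
  from continuous_map_compose[OF continuous_map_coeff this] show ?thesis
    by (simp add: o_def)
qed

text \<open>For fixed \<open>f\<close> and \<open>x\<close>, the defining condition is an equation between finite combinations of
  matrix coefficients, each of which is continuous.\<close>

lemma closedin_convolution_ops: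
  "closedin weak_operator_topology (convolution_ops :: ('n list ell2 \<Rightarrow>\<^sub>L 'n list ell2) set)"
proof -
  define E :: "'n list ell2 \<Rightarrow> 'n list \<Rightarrow> ('n list ell2 \<Rightarrow>\<^sub>L 'n list ell2) set"
    where "E f x = {A \<in> topspace weak_operator_topology.
      ell2_coeff (blinfun_apply A f) x - word_conv (symbol A) (ell2_coeff f) x \<in> {0}}" for f x
  have "closedin weak_operator_topology (E f x)" for f x
    unfolding E_def word_conv_def symbol_def
    by (rule closedin_continuous_map_preimage[where Y = euclidean])
      (auto intro!: continuous_map_diff continuous_map_sum continuous_map_coeff
        continuous_map_coeff_mult)
  then have "closedin weak_operator_topology (\<Inter>(f, x). E f x)"
    by (intro closedin_Inter) auto
  also have "(\<Inter>(f, x). E f x) = convolution_ops"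
    by (auto simp: E_def convolution_ops_def topspace_weak_operator_topology fun_eq_iff)
  finally show ?thesis .
qed

lemma nc_toeplitz_algebra_subset_convolution_ops: "\<LL> \<subseteq> convolution_ops"
  unfolding nc_toeplitz_algebra_def wot_algebra_generated_def
  using unital_subalgebra_convolution_ops closedin_convolution_ops left_mult_in_convolution_ops
  by blast


section \<open>Factorizations of words\<close>

lemma contractive_symbol_le_one:
  assumes "norm A \<le> 1"
  shows "norm (blinfun_apply A (\<xi> [])) \<le> 1" "cmod (symbol A x) \<le> 1"
proof -
  show *: "norm (blinfun_apply A (\<xi> [])) \<le> 1"
    using norm_blinfun[of A "\<xi> []"] assms by (simp add: norm_ket)
  show "cmod (symbol A x) \<le> 1"
    using cmod_coeff_le_norm[of "blinfun_apply A (\<xi> [])" x] * by (simp add: symbol_def)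
qed

lemma convolution_op_unimodular_coeff:
  assumes "A \<in> convolution_ops" "norm A \<le> 1" "cmod (symbol A u) = 1"
  shows "A = symbol A u *\<^sub>o \<L> u"
proof (rule convolution_ops_eqI[OF assms(1)])
  show "symbol A u *\<^sub>o \<L> u \<in> convolution_ops"
    by (intro scale_in_convolution_ops left_mult_in_convolution_ops)
  have "blinfun_apply A (\<xi> []) = symbol A u *\<^sub>\<complex> \<xi> u"
    using unimodular_coeff_imp_scaled_ket[OF contractive_symbol_le_one(1)[OF assms(2)]] assms(3)
    by (simp add: symbol_def)
  then have "symbol A = ell2_coeff (symbol A u *\<^sub>\<complex> \<xi> u)"
    by (simp add: symbol_def)
  also have "\<dots> = symbol (symbol A u *\<^sub>o \<L> u)"
    by (simp add: symbol_scale symbol_left_mult ell2_scale.rep_eq ket.rep_eq)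
  finally show "symbol A = symbol (symbol A u *\<^sub>o \<L> u)" .
qed

theorem theorem2p1:
  fixes w :: "'n::finite list" and B C :: "'n list ell2 \<Rightarrow>\<^sub>L 'n list ell2"
  assumes "B \<in> \<LL>" and "C \<in> \<LL>"
    and "norm B \<le> 1" and "norm C \<le> 1"
    and "\<L> w = B o\<^sub>L C"
  shows "\<exists>(u :: 'n list) (v :: 'n list) (c :: complex).
    w = u @ v \<and> cmod c = 1 \<and> B = c *\<^sub>o \<L> u \<and> C = cnj c *\<^sub>o \<L> v"
proof -
  have B: "B \<in> convolution_ops" and C: "C \<in> convolution_ops"
    using assms(1,2) nc_toeplitz_algebra_subset_convolution_ops by auto
  have "word_conv (symbol B) (symbol C) = (\<lambda>x. if x = w then 1 else 0)"
    by (simp add: symbol_left_mult flip: symbol_compose[OF B] assms(5))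
  then obtain u v where w: "w = u @ v" and prod: "symbol B u * symbol C v = 1"
    by (rule word_conv_eq_indicatorD)
  have "cmod (symbol B u) * cmod (symbol C v) = 1"
    using prod by (simp flip: norm_mult)
  moreover have "cmod (symbol B u) \<le> 1" "cmod (symbol C v) \<le> 1"
    using assms(3,4) by (auto intro: contractive_symbol_le_one)
  ultimately have unimodular: "cmod (symbol B u) = 1" "cmod (symbol C v) = 1"
    using mult_left_le[of "cmod (symbol C v)" "cmod (symbol B u)"]
      mult_left_le[of "cmod (symbol B u)" "cmod (symbol C v)"] by (auto simp: mult.commute)
  have "symbol C v = inverse (symbol B u)"
    using prod by (metis inverse_unique)
  also have "\<dots> = cnj (symbol B u)"
    using complex_div_cnj[of 1 "symbol B u"] unimodular(1) by (simp add: divide_inverse)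
  finally have "symbol C v = cnj (symbol B u)" .
  then have "C = cnj (symbol B u) *\<^sub>o \<L> v"
    using convolution_op_unimodular_coeff[OF C assms(4) unimodular(2)] by metis
  then show ?thesis
    using w unimodular(1) convolution_op_unimodular_coeff[OF B assms(3) unimodular(1)] by blast
qed

end
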